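(* Every (finitely generated, Gromov) hyperbolic group has the $U$-property.
   Context: Let $\Gamma$ be a finitely generated group with finite generating set $S$ and word length $\Vert\cdot\Vert$. The translation length is $\ell(\gamma)=\inf_{\eta\in\Gamma}\Vert\eta\gamma\eta^{-1}\Vert$. The group $\Gamma$ has the $U$-property (is undistorted in its conjugacy classes) if there exist finitely many elements $g_1,\dots,g_p\in\Gamma$ and positive constants $A,B$ such that for all $\gamma\in\Gamma$, $\Vert\gamma\Vert\leqslant A\sup_{1\leqslant i\leqslant p}\ell(g_i\gamma)+B$ (this does not depend on $S$). With $d$ the word distance, $e$ the identity, and Gromov product $\langle g,h\rangle=\frac12(d(g,e)+d(h,e)-d(g,h))$, $\Gamma$ is hyperbolic if for some $\delta$ one has $\langle g,k\rangle\geqslant\inf(\langle g,h\rangle,\langle h,k\rangle)-\delta$ for all $g,h,k\in\Gamma$. *)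

theory Defs
  imports Complex_Main "HOL-Algebra.Generated_Groups"
begin

definition generating_set :: "('a, 'b) monoid_scheme \<Rightarrow> 'a set \<Rightarrow> bool" where
  "generating_set G S \<longleftrightarrow> S \<subseteq> carrier G \<and> generate G S = carrier G"

(* Words are lists of letters from S and its inverses; S itself need not be symmetric.
   LEAST is only meaningful for elements of the subgroup generated by S. *)
definition word_length :: "('a, 'b) monoid_scheme \<Rightarrow> 'a set \<Rightarrow> 'a \<Rightarrow> nat" where
  "word_length G S g =
     (LEAST n. \<exists>ws. length ws = n \<and> set ws \<subseteq> S \<union> m_inv G ` S \<and>
                    foldr (mult G) ws (one G) = g)"

definition translation_length :: "('a, 'b) monoid_scheme \<Rightarrow> 'a set \<Rightarrow> 'a \<Rightarrow> nat" where
  "translation_length G S g =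
     (INF h\<in>carrier G. word_length G S (h \<otimes>\<^bsub>G\<^esub> g \<otimes>\<^bsub>G\<^esub> inv\<^bsub>G\<^esub> h))"

(* The index range 1..p is required to be nonempty, so the supremum is a maximum. *)
definition U_property :: "('a, 'b) monoid_scheme \<Rightarrow> 'a set \<Rightarrow> bool" where
  "U_property G S \<longleftrightarrow>
     (\<exists>(p::nat) (g :: nat \<Rightarrow> 'a) (A::real) (B::real).
        p \<ge> 1 \<and> (\<forall>i\<in>{1..p}. g i \<in> carrier G) \<and> A > 0 \<and> B > 0 \<and>
        (\<forall>x\<in>carrier G. real (word_length G S x)
            \<le> A * (SUP i\<in>{1..p}. real (translation_length G S (g i \<otimes>\<^bsub>G\<^esub> x))) + B))"

(* The left-invariant word distance. *)
definition word_dist :: "('a, 'b) monoid_scheme \<Rightarrow> 'a set \<Rightarrow> 'a \<Rightarrow> 'a \<Rightarrow> real" where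
  "word_dist G S g h = real (word_length G S (inv\<^bsub>G\<^esub> g \<otimes>\<^bsub>G\<^esub> h))"

definition gromov_product :: "('a, 'b) monoid_scheme \<Rightarrow> 'a set \<Rightarrow> 'a \<Rightarrow> 'a \<Rightarrow> real" where
  "gromov_product G S g h =
     (word_dist G S g \<one>\<^bsub>G\<^esub> + word_dist G S h \<one>\<^bsub>G\<^esub> - word_dist G S g h) / 2"

definition hyperbolic :: "('a, 'b) monoid_scheme \<Rightarrow> 'a set \<Rightarrow> bool" where
  "hyperbolic G S \<longleftrightarrow>
     (\<exists>\<delta>::real. \<forall>g\<in>carrier G. \<forall>h\<in>carrier G. \<forall>k\<in>carrier G.
        gromov_product G S g k
          \<ge> min (gromov_product G S g h) (gromov_product G S h k) - \<delta>)"

end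

theory Submission
  imports Defs "HOL-Complex_Analysis.Great_Picard"
begin

text \<open>
  The four-point inequality for 1, f, f^2 and f y, with y realising the translation length of f,
  gives l(f) \<ge> |f^2| - |f| - 2\<delta> = |f| - 2<f, f^{-1}> - 2\<delta>.

  If some finite set F displaces every x, in the sense that <x, h x> is bounded for some h in F,
  then <x, x^{-1}> or <h x, x^{-1}> is bounded, and the elements 1 and h of F do the job.

  Otherwise there are x_n with <x_n, h x_n> tending to infinity for every h: the whole group fixes a
  boundary point. Along a subsequence the Busemann functions of x_n converge to a quasimorphism q.
  It is proper, because elements with bounded q displace points p far along a geodesic to x_n by a
  bounded amount, so that conjugation by p injects any finite set of them into one fixed ball.
  A proper quasimorphism bounds the word length linearly, and, being almost invariant under
  conjugation, is itself bounded by the translation length; so the single element 1 suffices.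
\<close>

section \<open>Word length and word metric of a finitely generated group\<close>

locale word_metric_group = group G for G (structure) +
  fixes S
  assumes finite_S: "finite S" and gen_S: "generating_set G S"
begin

abbreviation len :: "'a \<Rightarrow> real" where "len x \<equiv> real (word_length G S x)"
abbreviation wd :: "'a \<Rightarrow> 'a \<Rightarrow> real" where "wd \<equiv> word_dist G S"
abbreviation gp :: "'a \<Rightarrow> 'a \<Rightarrow> real" where "gp \<equiv> gromov_product G S"
abbreviation letters :: "'a set" where "letters \<equiv> S \<union> m_inv G ` S"
abbreviation eval_word :: "'a list \<Rightarrow> 'a" where "eval_word ws \<equiv> foldr (\<otimes>) ws \<one>"

lemma letters_closed: "letters \<subseteq> carrier G"
  using gen_S by (auto simp: generating_set_def)

lemma eval_word_closed: "set ws \<subseteq> letters \<Longrightarrow> eval_word ws \<in> carrier G"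
  using letters_closed by (induction ws) auto

lemma eval_word_append:
  "set us \<subseteq> letters \<Longrightarrow> set vs \<subseteq> letters \<Longrightarrow> eval_word (us @ vs) = eval_word us \<otimes> eval_word vs"
proof (induction us)
  case Nil
  then show ?case using eval_word_closed by simp
next
  case (Cons a us)
  then have "a \<in> carrier G" using letters_closed by auto
  with Cons show ?case
    using eval_word_closed[of us] eval_word_closed[of vs] by (simp add: m_assoc)
qed

lemma inv_letter: "a \<in> letters \<Longrightarrow> inv a \<in> letters"
proof (elim UnE imageE)
  fix s assume "s \<in> S" "a = inv s"
  then show ?thesis using letters_closed by (simp add: subset_iff)
qed simp

lemma inv_eval_word:
  "set us \<subseteq> letters \<Longrightarrow> eval_word (rev (map (m_inv G) us)) = inv (eval_word us)"
proof (induction us)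
  case Nil
  then show ?case by simp
next
  case (Cons a us)
  then have "a \<in> letters" and us: "set us \<subseteq> letters" by simp_all
  then have a: "a \<in> carrier G" "inv a \<in> letters" using letters_closed inv_letter by blast+
  have "set (rev (map (m_inv G) us)) \<subseteq> letters" using inv_letter us unfolding set_rev set_map by blast
  with Cons a us show ?case
    using eval_word_append[of "rev (map (m_inv G) us)" "[inv a]"] eval_word_closed[of us]
    by (simp add: inv_mult_group)
qed

text \<open>Every element is spelled by some word, so the \<open>LEAST\<close> in
  \<open>word_length\<close> is meaningful on the whole carrier.\<close>

lemma ex_word:
  assumes "x \<in> carrier G"
  shows "\<exists>ws. set ws \<subseteq> letters \<and> eval_word ws = x"
proof -
  have "x \<in> generate G S" using assms gen_S by (simp add: generating_set_def)
  then show ?thesis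
  proof induction
    case one
    show ?case by (rule exI[of _ "[]"]) simp
  next
    case (incl h)
    then show ?case using letters_closed by (intro exI[of _ "[h]"]) auto
  next
    case (inv h)
    then show ?case using letters_closed by (intro exI[of _ "[inv h]"]) auto
  next
    case (eng h1 h2)
    then obtain us vs where "set us \<subseteq> letters" "eval_word us = h1" "set vs \<subseteq> letters" "eval_word vs = h2"
      by auto
    then show ?case using eval_word_append[of us vs] by (intro exI[of _ "us @ vs"]) auto
  qed
qed

lemma word_length_le: "set ws \<subseteq> letters \<Longrightarrow> word_length G S (eval_word ws) \<le> length ws"
  unfolding word_length_def by (rule Least_le) auto

lemma ex_geodesic_word:
  assumes "x \<in> carrier G"
  obtains ws where "set ws \<subseteq> letters" "eval_word ws = x" "length ws = word_length G S x"
proof -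
  let ?P = "\<lambda>n. \<exists>ws. length ws = n \<and> set ws \<subseteq> letters \<and> eval_word ws = x"
  obtain us where "set us \<subseteq> letters" "eval_word us = x" using ex_word[OF assms] by blast
  then have "?P (length us)" by blast
  then have "?P (LEAST n. ?P n)" by (rule LeastI)
  then show ?thesis using that unfolding word_length_def by blast
qed

lemma len_one: "len \<one> = 0"
  using word_length_le[of "[]"] by simp

lemma len_mult:
  assumes "x \<in> carrier G" "y \<in> carrier G"
  shows "len (x \<otimes> y) \<le> len x + len y"
proof -
  obtain us vs where "set us \<subseteq> letters" "eval_word us = x" "length us = word_length G S x"
    "set vs \<subseteq> letters" "eval_word vs = y" "length vs = word_length G S y"
    using ex_geodesic_word assms by metis
  then show ?thesis using word_length_le[of "us @ vs"] eval_word_append[of us vs] by simp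
qed

lemma len_inv:
  assumes "x \<in> carrier G"
  shows "len (inv x) = len x"
proof -
  have le: "word_length G S (inv y) \<le> word_length G S y" if "y \<in> carrier G" for y
  proof -
    obtain us where us: "set us \<subseteq> letters" "eval_word us = y" "length us = word_length G S y"
      using ex_geodesic_word \<open>y \<in> carrier G\<close> by metis
    moreover have "set (rev (map (m_inv G) us)) \<subseteq> letters" using inv_letter us(1) unfolding set_rev set_map by blast
    ultimately show ?thesis
      using word_length_le[of "rev (map (m_inv G) us)"] inv_eval_word[of us] by simp
  qed
  show ?thesis using le[of x] le[of "inv x"] assms by simp
qed

lemma finite_ball: "finite {x \<in> carrier G. len x \<le> r}"
proof -
  have "{x \<in> carrier G. len x \<le> r} \<subseteq>
      eval_word ` {ws. set ws \<subseteq> letters \<and> length ws \<le> nat \<lfloor>r\<rfloor>}"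
  proof
    fix x assume x: "x \<in> {x \<in> carrier G. len x \<le> r}"
    obtain ws where "set ws \<subseteq> letters" "eval_word ws = x" "length ws = word_length G S x"
      using ex_geodesic_word x by blast
    with x show "x \<in> eval_word ` {ws. set ws \<subseteq> letters \<and> length ws \<le> nat \<lfloor>r\<rfloor>}"
      by (auto simp: le_nat_floor intro!: rev_image_eqI[of ws])
  qed
  moreover have "finite {ws. set ws \<subseteq> letters \<and> length ws \<le> nat \<lfloor>r\<rfloor>}"
    using finite_S by (intro finite_lists_length_le) auto
  ultimately show ?thesis using finite_surj by blast
qed

text \<open>Balls are finite and exhaust the group. Countability is what permits the diagonal
  extraction of a subsequence converging at every group element.\<close>

lemma countable_carrier: "countable (carrier G)"
proof -
  have "carrier G = (\<Union>n::nat. {x \<in> carrier G. len x \<le> real n})"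
    using of_nat_le_iff by blast
  moreover have "countable (\<Union>n::nat. {x \<in> carrier G. len x \<le> real n})"
    by (simp add: countable_finite finite_ball del: of_nat_le_iff)
  ultimately show ?thesis by simp
qed

text \<open>Cut a shortest word for x after k letters. The two pieces have lengths at most k and len
  x - k; by the triangle inequality both bounds are equalities.\<close>

lemma ex_point_on_geodesic:
  assumes x: "x \<in> carrier G" and k: "k \<le> word_length G S x"
  obtains p where "p \<in> carrier G" "len p = real k" "len (inv p \<otimes> x) = len x - real k"
proof -
  obtain ws where ws: "set ws \<subseteq> letters" "eval_word ws = x" "length ws = word_length G S x"
    using ex_geodesic_word x by blast
  define p q where "p = eval_word (take k ws)" and "q = eval_word (drop k ws)"
  have "set (take k ws) \<subseteq> letters" "set (drop k ws) \<subseteq> letters"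
    using ws(1) set_take_subset[of k ws] set_drop_subset[of k ws] by auto
  then have cl: "p \<in> carrier G" "q \<in> carrier G" and xpq: "x = p \<otimes> q"
    and "len p \<le> length (take k ws)" "len q \<le> length (drop k ws)"
    using eval_word_append[of "take k ws" "drop k ws"] eval_word_closed ws(2)
      word_length_le[of "take k ws"] word_length_le[of "drop k ws"]
    by (auto simp: p_def q_def)
  then have "len p \<le> real k" "len q \<le> len x - real k" using ws(3) k by auto
  moreover have "len x \<le> len p + len q" using len_mult cl xpq by simp
  moreover have "inv p \<otimes> x = q" using cl unfolding xpq by (simp flip: m_assoc)
  ultimately show ?thesis using that cl by force
qed

lemma wd_commute: "x \<in> carrier G \<Longrightarrow> y \<in> carrier G \<Longrightarrow> wd x y = wd y x"
  using len_inv[of "inv x \<otimes> y"] by (simp add: word_dist_def inv_mult_group)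

lemma wd_one: "x \<in> carrier G \<Longrightarrow> wd x \<one> = len x"
  by (simp add: word_dist_def len_inv)

lemma inv_mult_cancel_left: "x \<in> carrier G \<Longrightarrow> y \<in> carrier G \<Longrightarrow> inv x \<otimes> (x \<otimes> y) = y"
  by (simp flip: m_assoc)

lemma mult_inv_cancel_left: "x \<in> carrier G \<Longrightarrow> y \<in> carrier G \<Longrightarrow> x \<otimes> (inv x \<otimes> y) = y"
  by (simp flip: m_assoc)

lemma wd_mult_left:
  "g \<in> carrier G \<Longrightarrow> x \<in> carrier G \<Longrightarrow> y \<in> carrier G \<Longrightarrow> wd (g \<otimes> x) (g \<otimes> y) = wd x y"
  by (simp add: word_dist_def inv_mult_group m_assoc inv_mult_cancel_left)

lemma wd_triangle:
  assumes "x \<in> carrier G" "y \<in> carrier G" "z \<in> carrier G"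
  shows "wd x z \<le> wd x y + wd y z"
proof -
  have "inv x \<otimes> z = (inv x \<otimes> y) \<otimes> (inv y \<otimes> z)"
    using assms by (simp add: m_assoc mult_inv_cancel_left)
  then show ?thesis using len_mult[of "inv x \<otimes> y" "inv y \<otimes> z"] assms by (simp add: word_dist_def)
qed

lemma gp_eq:
  "x \<in> carrier G \<Longrightarrow> y \<in> carrier G \<Longrightarrow> gp x y = len x / 2 + len y / 2 - wd x y / 2"
  by (simp add: gromov_product_def wd_one field_simps)

lemma gp_commute: "x \<in> carrier G \<Longrightarrow> y \<in> carrier G \<Longrightarrow> gp x y = gp y x"
  by (simp add: gp_eq wd_commute)

lemma gp_le_len:
  assumes "x \<in> carrier G" "y \<in> carrier G"
  shows "gp x y \<le> len y"
  using wd_triangle[of x y \<one>] assms by (simp add: gp_eq wd_one)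

lemma gp_lipschitz:
  assumes "x \<in> carrier G" "y \<in> carrier G" "z \<in> carrier G"
  shows "gp x y \<le> gp x z + wd y z"
  using wd_triangle[of x y z] wd_triangle[of y z \<one>] assms
  unfolding gp_eq[OF assms(1,2)] gp_eq[OF assms(1,3)] by (simp add: wd_one)

section \<open>Translation length, criteria for the U-property, quasimorphisms\<close>

lemma translation_length_attained:
  obtains h where "h \<in> carrier G" "translation_length G S g = word_length G S (h \<otimes> g \<otimes> inv h)"
proof -
  have "translation_length G S g \<in> (\<lambda>h. word_length G S (h \<otimes> g \<otimes> inv h)) ` carrier G"
    unfolding translation_length_def by (rule Inf_nat_def1) auto
  then show ?thesis using that by blast
qed

text \<open>Replaces the indexed family by a finite set and the supremum by a single member g, which
  may depend on x. The constant \<open>max B 1\<close> supplies the positivity demanded by the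
  definition.\<close>

lemma U_propertyI:
  assumes F: "finite F" "F \<noteq> {}" "F \<subseteq> carrier G" and A: "A > 0"
    and le: "\<And>x. x \<in> carrier G \<Longrightarrow> \<exists>g\<in>F. len x \<le> A * real (translation_length G S (g \<otimes> x)) + B"
  shows "U_property G S"
proof -
  obtain g where g: "bij_betw g {1..card F} F"
    using ex_bij_betw_nat_finite_1[OF F(1)] by blast
  have "len x \<le> A * (SUP i\<in>{1..card F}. real (translation_length G S (g i \<otimes> x))) + max B 1"
    if x: "x \<in> carrier G" for x
  proof -
    obtain h where h: "h \<in> F" "len x \<le> A * real (translation_length G S (h \<otimes> x)) + B"
      using le[OF x] by blast
    then obtain i where i: "i \<in> {1..card F}" "h = g i" using g unfolding bij_betw_def by blast
    have "real (translation_length G S (g i \<otimes> x))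
        \<le> (SUP i\<in>{1..card F}. real (translation_length G S (g i \<otimes> x)))"
      using i(1) by (intro cSUP_upper) auto
    then have "A * real (translation_length G S (g i \<otimes> x))
        \<le> A * (SUP i\<in>{1..card F}. real (translation_length G S (g i \<otimes> x)))"
      using A by (intro mult_left_mono) auto
    then show ?thesis using h(2) i(2) by simp
  qed
  moreover have "\<forall>i\<in>{1..card F}. g i \<in> carrier G" using g F(3) by (auto simp: bij_betw_def)
  moreover have "1 \<le> card F" using F by (simp add: Suc_le_eq card_gt_0_iff)
  ultimately show ?thesis unfolding U_property_def using A
    by (intro exI[of _ "card F"] exI[of _ g] exI[of _ A] exI[of _ "max B 1"]) auto
qed

text \<open>Multiplying by a fixed t with q t large, or by its inverse, lowers |q g| by at least 1 at the
  cost of |t| letters.\<close>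
lemma proper_quasimorphism_bound:
  assumes qm: "\<And>g h. g \<in> carrier G \<Longrightarrow> h \<in> carrier G \<Longrightarrow> \<bar>q (g \<otimes> h) - q g - q h\<bar> \<le> D"
    and le_len: "\<And>g. g \<in> carrier G \<Longrightarrow> \<bar>q g\<bar> \<le> len g"
    and proper: "\<And>K. finite {g \<in> carrier G. \<bar>q g\<bar> \<le> K}"
  shows "\<exists>A>0. \<exists>B. \<forall>g\<in>carrier G. len g \<le> A * \<bar>q g\<bar> + B"
proof -
  have ball: "\<exists>M. \<forall>g\<in>carrier G. \<bar>q g\<bar> \<le> K \<longrightarrow> len g \<le> M" for K
  proof -
    have "\<forall>g\<in>carrier G. \<bar>q g\<bar> \<le> K \<longrightarrow> len g \<le> Max (len ` {g \<in> carrier G. \<bar>q g\<bar> \<le> K})"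
      using proper[of K] by (auto intro!: Max_ge)
    then show ?thesis by blast
  qed
  have D: "0 \<le> D" using qm[of \<one> \<one>] by simp
  have q_one: "q \<one> = 0" using le_len[of \<one>] len_one by simp
  have q_inv: "\<bar>q g + q (inv g)\<bar> \<le> D" if "g \<in> carrier G" for g
    using qm[of g "inv g"] that q_one by simp
  show ?thesis
  \<comment> \<open>If q is bounded by 2 D + 1, properness makes the group finite; otherwise there
    is an element to step with.\<close>
  proof (cases "\<forall>g\<in>carrier G. \<bar>q g\<bar> \<le> 2 * D + 1")
    case True
    obtain M where M: "\<forall>g\<in>carrier G. \<bar>q g\<bar> \<le> 2 * D + 1 \<longrightarrow> len g \<le> M" using ball by blast
    have "len g \<le> 1 * \<bar>q g\<bar> + M" if "g \<in> carrier G" for g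
      using M True that by (smt (verit))
    then show ?thesis by (intro exI[of _ 1]) auto
  next
    case False
    then obtain t0 where t0: "t0 \<in> carrier G" "\<bar>q t0\<bar> > 2 * D + 1" by force
    \<comment> \<open>Since q (inv t0) equals - q t0 up to D, either t0 or its inverse qualifies.
      The margin D + 1 makes a step gain at least 1 after the defect D is paid.\<close>
    obtain t where t: "t \<in> carrier G" "q t > D + 1" "q (inv t) < - (D + 1)"
    proof (cases "q t0 > 0")
      case True
      then show ?thesis using that[of t0] t0 q_inv[of t0] D by linarith
    next
      case False
      then show ?thesis using that[of "inv t0"] t0 q_inv[of t0] D by simp
    qed
    \<comment> \<open>Large enough that a step from outside [-K - n, K + n] back towards 0 cannot
      overshoot the opposite end.\<close>
    define K where "K = q t + 2 * D + 1"
    obtain M where M: "\<forall>g\<in>carrier G. \<bar>q g\<bar> \<le> K \<longrightarrow> len g \<le> M" using ball by blast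
    have steps: "len g \<le> M + real n * len t" if "g \<in> carrier G" "\<bar>q g\<bar> \<le> K + real n" for g n
      using that
    proof (induction n arbitrary: g)
      case 0
      then show ?case using M by simp
    next
      case (Suc n)
      have step: ?case if s: "s \<in> carrier G" "len s = len t" "\<bar>q (g \<otimes> s)\<bar> \<le> K + real n" for s
      proof -
        have "g = (g \<otimes> s) \<otimes> inv s" using s(1) Suc.prems(1) by (simp add: m_assoc)
        then have "len g \<le> len (g \<otimes> s) + len t"
          using len_mult[of "g \<otimes> s" "inv s"] len_inv[of s] s Suc.prems(1) by simp
        then show ?thesis
          using Suc.IH[of "g \<otimes> s"] s Suc.prems(1) by (simp add: algebra_simps)
      qed
      consider "\<bar>q g\<bar> \<le> K + real n" | "q g > K + real n" | "q g < - (K + real n)" by linarith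
      then show ?case
      proof cases
        case 1
        then have "len g \<le> M + real n * len t" using Suc by blast
        then show ?thesis by (simp add: algebra_simps)
      next
        case 2
        then have "\<bar>q (g \<otimes> inv t)\<bar> \<le> K + real n"
          using qm[of g "inv t"] q_inv[of t] t Suc.prems D unfolding K_def by auto
        then show ?thesis using step[of "inv t"] t(1) len_inv[of t] by simp
      next
        case 3
        then have "\<bar>q (g \<otimes> t)\<bar> \<le> K + real n"
          using qm[of g t] t Suc.prems D unfolding K_def by auto
        then show ?thesis using step[of t] t(1) by simp
      qed
    qed
    have "len g \<le> (len t + 1) * \<bar>q g\<bar> + (M + len t)" if g: "g \<in> carrier G" for g
    proof -
      let ?n = "nat \<lceil>\<bar>q g\<bar>\<rceil>"
      have "\<bar>q g\<bar> \<le> K + real ?n" using D t(2) unfolding K_def by linarith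
      then have "len g \<le> M + real ?n * len t" using steps g by blast
      also have "real ?n * len t \<le> (\<bar>q g\<bar> + 1) * len t" by (intro mult_right_mono) linarith+
      finally show ?thesis by (simp add: algebra_simps)
    qed
    moreover have "0 < len t + 1" by simp
    ultimately show ?thesis by blast
  qed
qed

text \<open>Choose a conjugate realising the translation length. Splitting its q-value into those of
  h, g and inv h, and then cancelling q h against q (inv h), uses the defect three times.\<close>

lemma quasimorphism_le_translation_length:
  assumes qm: "\<And>g h. g \<in> carrier G \<Longrightarrow> h \<in> carrier G \<Longrightarrow> \<bar>q (g \<otimes> h) - q g - q h\<bar> \<le> D"
    and le_len: "\<And>g. g \<in> carrier G \<Longrightarrow> \<bar>q g\<bar> \<le> len g"
    and g: "g \<in> carrier G"
  shows "\<bar>q g\<bar> \<le> real (translation_length G S g) + 3 * D"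
proof -
  obtain h where h: "h \<in> carrier G" "translation_length G S g = word_length G S (h \<otimes> g \<otimes> inv h)"
    using translation_length_attained by blast
  have "q \<one> = 0" using le_len[of \<one>] len_one by simp
  then show ?thesis
    using qm[of "h \<otimes> g" "inv h"] qm[of h g] qm[of h "inv h"] le_len[of "h \<otimes> g \<otimes> inv h"] g h by simp
qed

lemma proper_quasimorphism_imp_U_property:
  assumes qm: "\<And>g h. g \<in> carrier G \<Longrightarrow> h \<in> carrier G \<Longrightarrow> \<bar>q (g \<otimes> h) - q g - q h\<bar> \<le> D"
    and le_len: "\<And>g. g \<in> carrier G \<Longrightarrow> \<bar>q g\<bar> \<le> len g"
    and proper: "\<And>K. finite {g \<in> carrier G. \<bar>q g\<bar> \<le> K}"
  shows "U_property G S"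
proof -
  obtain A B where A: "A > 0" and B: "\<forall>g\<in>carrier G. len g \<le> A * \<bar>q g\<bar> + B"
    using proper_quasimorphism_bound[OF qm le_len proper] by blast
  have "len x \<le> A * real (translation_length G S (\<one> \<otimes> x)) + (A * (3 * D) + B)"
    if x: "x \<in> carrier G" for x
  proof -
    have "A * \<bar>q x\<bar> \<le> A * (real (translation_length G S x) + 3 * D)"
      using quasimorphism_le_translation_length[OF qm le_len x] A by (intro mult_left_mono) auto
    then show ?thesis using B x by (auto simp: algebra_simps)
  qed
  then show ?thesis using A by (intro U_propertyI[of "{\<one>}"]) auto
qed

end

section \<open>Hyperbolicity and the displacing case\<close>

locale hyperbolic_word_group = word_metric_group +
  fixes \<delta> :: real
  assumes hyp: "\<And>x y z. x \<in> carrier G \<Longrightarrow> y \<in> carrier G \<Longrightarrow> z \<in> carrier G \<Longrightarrow>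
    min (gp x y) (gp y z) - \<delta> \<le> gp x z"
begin

lemma delta_nonneg: "0 \<le> \<delta>"
  using hyp[of \<one> \<one> \<one>] by simp

text \<open>Left translation by inv w moves the base point of the Gromov product from \<one> to w,
  where this is the defining inequality written out in distances.\<close>

lemma four_point:
  assumes "a \<in> carrier G" "b \<in> carrier G" "c \<in> carrier G" "w \<in> carrier G"
  shows "wd a b + wd c w \<le> max (wd a c + wd b w) (wd a w + wd b c) + 2 * \<delta>"
proof -
  let ?t = "\<lambda>x. inv w \<otimes> x"
  have d: "wd (?t x) (?t y) = wd x y" if "x \<in> carrier G" "y \<in> carrier G" for x y
    using wd_mult_left[of "inv w" x y] that assms by simp
  have n: "len (?t x) = wd x w" if "x \<in> carrier G" for x
    using wd_commute[of x w] that assms by (simp add: word_dist_def)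
  have "min (gp (?t a) (?t c)) (gp (?t c) (?t b)) - \<delta> \<le> gp (?t a) (?t b)"
    using hyp assms by simp
  then show ?thesis using assms wd_commute[of b c] by (simp add: gp_eq d n)
qed

lemma translation_length_ge:
  assumes f: "f \<in> carrier G"
  shows "len f - 2 * gp f (inv f) - 2 * \<delta> \<le> real (translation_length G S f)"
proof -
  obtain h where h: "h \<in> carrier G" "translation_length G S f = word_length G S (h \<otimes> f \<otimes> inv h)"
    using translation_length_attained by blast
  define y where "y = inv h"
  have y: "y \<in> carrier G" using h by (simp add: y_def)
  have l: "real (translation_length G S f) = wd y (f \<otimes> y)"
    using h f by (simp add: y_def word_dist_def m_assoc)
  \<comment> \<open>Both sums in the maximum are at most len f + wd \<one> y + l(f), and wd \<one> y
    cancels against wd f (f y) on the left.\<close>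
  have "wd \<one> (f \<otimes> f) + wd f (f \<otimes> y)
      \<le> max (wd \<one> f + wd (f \<otimes> f) (f \<otimes> y)) (wd \<one> (f \<otimes> y) + wd (f \<otimes> f) f) + 2 * \<delta>"
    using four_point f y by simp
  moreover have "wd \<one> (f \<otimes> f) = len (f \<otimes> f)" "wd \<one> f = len f"
    using f by (simp_all add: word_dist_def)
  moreover have "wd f (f \<otimes> y) = wd \<one> y" "wd (f \<otimes> f) f = len f"
    using wd_mult_left[of f \<one> y] wd_mult_left[of f f \<one>] f y by (simp_all add: wd_one)
  moreover have "wd (f \<otimes> f) (f \<otimes> y) \<le> wd \<one> y + wd y (f \<otimes> y)"
    using wd_mult_left[of f f y] wd_triangle[of f "f \<otimes> y" y] wd_mult_left[of f \<one> y]
      wd_commute[of "f \<otimes> y" y] f y by simp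
  moreover have "wd \<one> (f \<otimes> y) \<le> wd \<one> y + wd y (f \<otimes> y)"
    using wd_triangle f y by simp
  moreover have "gp f (inv f) = (2 * len f - len (f \<otimes> f)) / 2"
    using wd_commute[of f "inv f"] f by (simp add: gp_eq len_inv) (simp add: word_dist_def)
  ultimately show ?thesis using l by simp
qed

lemma U_property_if_displacing:
  assumes F: "finite F" "F \<subseteq> carrier G"
    and C: "\<And>x. x \<in> carrier G \<Longrightarrow> \<exists>h\<in>F. gp x (h \<otimes> x) \<le> C"
  shows "U_property G S"
proof -
  define M where "M = Max (len ` insert \<one> F)"
  have M: "len g \<le> M" if "g \<in> insert \<one> F" for g
    using F that unfolding M_def by (intro Max_ge) auto
  have "\<exists>g\<in>insert \<one> F. len x \<le> 1 * real (translation_length G S (g \<otimes> x)) + (3 * M + 2 * C + 4 * \<delta>)"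
    if x: "x \<in> carrier G" for x
  proof -
    obtain h where h: "h \<in> F" "gp x (h \<otimes> x) \<le> C" using C x by blast
    then have hc: "h \<in> carrier G" using F by blast
    have "min (gp x (inv x)) (gp (inv x) (h \<otimes> x)) \<le> C + \<delta>"
      using hyp[of x "inv x" "h \<otimes> x"] h hc x by simp
    then have "gp (\<one> \<otimes> x) (inv x) \<le> C + \<delta> \<or> gp (h \<otimes> x) (inv x) \<le> C + \<delta>"
      using gp_commute[of "inv x" "h \<otimes> x"] x hc by auto
    then obtain g where g: "g \<in> insert \<one> F" "gp (g \<otimes> x) (inv x) \<le> C + \<delta>" using h by blast
    then have gc: "g \<in> carrier G" using F by blast
    let ?f = "g \<otimes> x"
    \<comment> \<open>The inverse of g x is inv x followed by inv g, so replacing inv x by it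
      changes the Gromov product by at most M.\<close>
    have "wd (inv ?f) (inv x) = len g"
      using gc x by (simp add: word_dist_def inv_mult_group m_assoc)
    then have "gp ?f (inv ?f) \<le> C + \<delta> + M"
      using gp_lipschitz[of ?f "inv ?f" "inv x"] g M[of g] gc x by simp
    moreover have "len x \<le> len g + len ?f"
      using len_mult[of "inv g" ?f] gc x by (simp add: inv_mult_cancel_left len_inv)
    ultimately have "len x \<le> 1 * real (translation_length G S ?f) + (3 * M + 2 * C + 4 * \<delta>)"
      using translation_length_ge[of ?f] M[of g] g gc x by simp
    then show ?thesis using g by blast
  qed
  then show ?thesis using F by (intro U_propertyI[of "insert \<one> F" 1]) auto
qed

section \<open>Busemann functions and conjugation by points of a geodesic\<close>

text \<open>The Busemann function of a point x inside the group, normalised to vanish at \<one>. The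
  sign is chosen so that it is positive when h is closer to x than \<one> is.\<close>

definition busemann :: "'a \<Rightarrow> 'a \<Rightarrow> real" where
  "busemann x h = len x - wd h x"

lemma busemann_eq_gp:
  "x \<in> carrier G \<Longrightarrow> h \<in> carrier G \<Longrightarrow> busemann x h = 2 * gp x h - len h"
  by (simp add: busemann_def gp_eq wd_commute)

lemma abs_busemann_le:
  assumes "x \<in> carrier G" "h \<in> carrier G"
  shows "\<bar>busemann x h\<bar> \<le> len h"
  using assms wd_triangle[of h x \<one>] wd_triangle[of x h \<one>] wd_triangle[of h \<one> x]
    wd_commute[of x h] wd_commute[of \<one> x]
  by (simp add: busemann_def wd_one)

text \<open>An exact cocycle identity. It turns into additivity up to a bounded error once x and inv
  g x look alike from h.\<close>

lemma busemann_mult: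
  assumes "x \<in> carrier G" "g \<in> carrier G" "h \<in> carrier G"
  shows "busemann x (g \<otimes> h) = busemann x g + busemann (inv g \<otimes> x) h"
  using assms by (simp add: busemann_def word_dist_def inv_mult_group m_assoc)

lemma len_mult_eq_busemann:
  "x \<in> carrier G \<Longrightarrow> g \<in> carrier G \<Longrightarrow> len (g \<otimes> x) = len x - busemann x (inv g)"
  by (simp add: busemann_def word_dist_def)

text \<open>Gromov products with h are at most len h, hence at most <x, y>. So the minimum in the
  hyperbolicity inequality is always the product with h, and <x, h> and <y, h> differ by at most
  \<delta>.\<close>

lemma busemann_close:
  assumes "x \<in> carrier G" "y \<in> carrier G" "h \<in> carrier G" and "len h \<le> gp x y"
  shows "\<bar>busemann x h - busemann y h\<bar> \<le> 2 * \<delta>"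
  using assms hyp[of x y h] hyp[of y x h] gp_le_len[of x h] gp_le_len[of y h] gp_commute[of x y]
  by (simp add: busemann_eq_gp)

text \<open>Both p and g p lie close to the common initial segment of geodesics to x and g x, at
  positions that differ by about the Busemann value.\<close>
lemma conjugate_on_geodesic_bound:
  assumes x: "x \<in> carrier G" and g: "g \<in> carrier G" and p: "p \<in> carrier G"
    and lp: "len p = r" "len (inv p \<otimes> x) = len x - r"
    and gr: "len g \<le> r" and far: "2 * r \<le> gp x (g \<otimes> x)"
  shows "len (inv p \<otimes> g \<otimes> p) \<le> \<bar>busemann x (inv g)\<bar> + 6 * \<delta>"
proof -
  have px: "gp p x = r"
    using x p lp by (simp add: gp_eq word_dist_def field_simps)
  have "wd (g \<otimes> x) (g \<otimes> p) = len x - r"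
    using wd_mult_left[of g x p] wd_commute[of x p] x g p lp by (simp add: word_dist_def)
  then have gxp: "2 * gp (g \<otimes> x) (g \<otimes> p) = len (g \<otimes> p) + r - busemann x (inv g)"
    using x g p len_mult_eq_busemann[of x g] by (simp add: gp_eq field_simps)
  \<comment> \<open>Here <p, x> = r is at least len g, so p and x have nearly the same Busemann
    value b at inv g.\<close>
  have gp_le: "len (g \<otimes> p) \<le> r - busemann x (inv g) + 2 * \<delta>"
    using busemann_close[of p x "inv g"] px gr x g p lp len_mult_eq_busemann[of p g]
    by (simp add: len_inv)
  \<comment> \<open>Two applications of hyperbolicity along p, x, g x, g p, one case for each
    product that may be the least. With b the Busemann value, the conjugate has length at most -b +
    6 \<delta>, 4 \<delta> - r and b + 4 \<delta> respectively.\<close>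
  consider "r - 2 * \<delta> \<le> gp p (g \<otimes> p)" | "gp x (g \<otimes> x) - 2 * \<delta> \<le> gp p (g \<otimes> p)"
    | "gp (g \<otimes> x) (g \<otimes> p) - 2 * \<delta> \<le> gp p (g \<otimes> p)"
    using hyp[of p x "g \<otimes> x"] hyp[of p "g \<otimes> x" "g \<otimes> p"] px x g p delta_nonneg
    by (simp add: min_def split: if_splits)
  moreover have "2 * gp p (g \<otimes> p) = r + len (g \<otimes> p) - len (inv p \<otimes> g \<otimes> p)"
    using g p lp by (simp add: gp_eq word_dist_def m_assoc field_simps)
  moreover have "len (g \<otimes> p) \<le> 2 * r" using len_mult[of g p] g p lp gr by simp
  moreover have "0 \<le> r" using lp(1) by simp
  ultimately show ?thesis using gxp gp_le far delta_nonneg by cases linarith+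
qed

section \<open>The case of a fixed boundary point\<close>

lemma U_property_if_boundary_fixed:
  assumes x: "\<And>n. x n \<in> carrier G"
    and fixed: "\<And>g. g \<in> carrier G \<Longrightarrow> filterlim (\<lambda>n. gp (x n) (g \<otimes> x n)) at_top sequentially"
  shows "U_property G S"
proof -
  \<comment> \<open>normalised, since the extraction of the subsequence needs a bound uniform in g\<close>
  define f where "f n g = busemann (x n) g / (1 + len g)" for n g
  have "norm (f n g) \<le> 1" if "g \<in> carrier G" for n g
    using abs_busemann_le[of "x n" g] x that by (simp add: f_def)
  then obtain k :: "nat \<Rightarrow> nat" where k: "strict_mono k"
    and "\<And>g. g \<in> carrier G \<Longrightarrow> \<exists>l. (\<lambda>n. f (k n) g) \<longlonglongrightarrow> l"
    using function_convergent_subsequence[OF countable_carrier, of f 1] by blast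
  then obtain l where l: "\<And>g. g \<in> carrier G \<Longrightarrow> (\<lambda>n. f (k n) g) \<longlonglongrightarrow> l g"
    by metis
  define y where "y n = x (k n)" for n
  define q where "q g = l g * (1 + len g)" for g
  have y: "y n \<in> carrier G" for n using x by (simp add: y_def)
  have y_fixed: "eventually (\<lambda>n. C \<le> gp (y n) (g \<otimes> y n)) sequentially" if "g \<in> carrier G" for g C
    using filterlim_compose[OF fixed[OF that] filterlim_subseq[OF k]]
    by (simp add: filterlim_at_top y_def)
  have lim: "(\<lambda>n. busemann (y n) g) \<longlonglongrightarrow> q g" if "g \<in> carrier G" for g
  proof -
    have "1 + len g \<noteq> 0" by linarith
    then show ?thesis
      using tendsto_mult_right[OF l[OF that], of "1 + len g"] by (simp add: y_def q_def f_def)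
  qed
  show ?thesis
  proof (rule proper_quasimorphism_imp_U_property)
    fix g h assume g: "g \<in> carrier G" and h: "h \<in> carrier G"
    have "(\<lambda>n. \<bar>busemann (y n) (g \<otimes> h) - busemann (y n) g - busemann (y n) h\<bar>)
        \<longlonglongrightarrow> \<bar>q (g \<otimes> h) - q g - q h\<bar>"
      using g h by (intro tendsto_intros lim) auto
    moreover have "eventually (\<lambda>n. \<bar>busemann (y n) (g \<otimes> h) - busemann (y n) g - busemann (y n) h\<bar>
        \<le> 2 * \<delta>) sequentially"
      \<comment> \<open>Eventually y n and inv g y n agree on the ball of radius len h up to 2
        \<delta>, so the cocycle identity makes the defect at most 2 \<delta>.\<close>
      using y_fixed[of "inv g" "len h"]
    proof (rule eventually_mono)
      fix n assume "len h \<le> gp (y n) (inv g \<otimes> y n)"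
      then show "\<bar>busemann (y n) (g \<otimes> h) - busemann (y n) g - busemann (y n) h\<bar> \<le> 2 * \<delta>"
        using busemann_close[of "y n" "inv g \<otimes> y n" h] busemann_mult[of "y n" g h] y g h by simp
    qed (use g in simp)
    ultimately show "\<bar>q (g \<otimes> h) - q g - q h\<bar> \<le> 2 * \<delta>"
      by (rule tendsto_upperbound) simp
  next
    fix g assume g: "g \<in> carrier G"
    show "\<bar>q g\<bar> \<le> len g"
      using tendsto_rabs[OF lim[OF g]] by (rule tendsto_upperbound) (use abs_busemann_le y g in auto)
  next
    fix K
    let ?ball = "{g \<in> carrier G. len g \<le> K + 1 + 6 * \<delta>}"
    \<comment> \<open>Stated for inv g to match \<open>conjugate_on_geodesic_bound\<close>;
      inversion transfers it back at the end.\<close>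
    have "finite {g \<in> carrier G. \<bar>q (inv g)\<bar> \<le> K}" (is "finite ?L")
    \<comment> \<open>The index n and the point p depend on the finite subset F, but the ball
      receiving the conjugates does not. Its cardinality bounds all F uniformly.\<close>
    proof (rule finite_if_finite_subsets_card_bdd[THEN conjunct1])
      fix F assume F: "F \<subseteq> ?L" "finite F"
      define r where "r = Max (word_length G S ` insert \<one> F)"
      have r: "word_length G S g \<le> r" if "g \<in> F" for g
        using F that unfolding r_def by (intro Max_ge) auto
      have "eventually (\<lambda>n. \<bar>busemann (y n) (inv g)\<bar> < K + 1) sequentially" if "g \<in> F" for g
        using tendsto_rabs[OF lim[of "inv g"]] F that by (intro order_tendstoD(2)) auto
      \<comment> \<open>Including \<one> gives 2 r \<le> <y n, y n> = len (y n), so a geodesic to y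
        n has a point at distance r.\<close>
      then have "eventually (\<lambda>n. (\<forall>g\<in>F. \<bar>busemann (y n) (inv g)\<bar> < K + 1)
          \<and> (\<forall>g\<in>insert \<one> F. 2 * real r \<le> gp (y n) (g \<otimes> y n))) sequentially"
        using F by (intro eventually_conj eventually_ball_finite ballI y_fixed) auto
      then obtain n where n: "\<And>g. g \<in> F \<Longrightarrow> \<bar>busemann (y n) (inv g)\<bar> < K + 1"
        "\<And>g. g \<in> insert \<one> F \<Longrightarrow> 2 * real r \<le> gp (y n) (g \<otimes> y n)"
        unfolding eventually_sequentially by blast
      have "real r \<le> len (y n)" using n(2)[of \<one>] gp_le_len[of "y n" "y n"] y by simp
      then obtain p where p: "p \<in> carrier G" "len p = real r" "len (inv p \<otimes> y n) = len (y n) - real r"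
        using ex_point_on_geodesic[of "y n" r] y by auto
      have "len (inv p \<otimes> g \<otimes> p) \<le> K + 1 + 6 * \<delta>" if "g \<in> F" for g
        using conjugate_on_geodesic_bound[of "y n" g p "real r"] n[of g] p y r[of g] F that by fastforce
      then have "(\<lambda>g. inv p \<otimes> g \<otimes> p) ` F \<subseteq> ?ball" using F p by auto
      moreover have "inj_on (\<lambda>g. inv p \<otimes> g \<otimes> p) F"
        using F p by (intro inj_onI) (auto simp: subset_iff)
      ultimately show "card F \<le> card ?ball"
        using finite_ball card_inj_on_le by blast
    qed
    then have "finite (m_inv G ` ?L)" by simp
    moreover have "{g \<in> carrier G. \<bar>q g\<bar> \<le> K} \<subseteq> m_inv G ` ?L"
      by (auto intro!: rev_image_eqI[of "inv _"])
    ultimately show "finite {g \<in> carrier G. \<bar>q g\<bar> \<le> K}" by (rule rev_finite_subset)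
  qed
qed

section \<open>The dichotomy\<close>

lemma U_property_hyperbolic: "U_property G S"
proof (cases "\<exists>C F. finite F \<and> F \<subseteq> carrier G \<and> (\<forall>x\<in>carrier G. \<exists>h\<in>F. gp x (h \<otimes> x) \<le> C)")
  case True
  then show ?thesis using U_property_if_displacing by blast
next
  case False
  have "\<exists>x\<in>carrier G. \<forall>h\<in>carrier G. len h \<le> real n \<longrightarrow> real n < gp x (h \<otimes> x)" for n :: nat
  proof -
    \<comment> \<open>The finite ball of radius n serves as F, with C = n. A fixed h lies in these
      balls from n = len h on, which yields divergence of <x n, h x n> for every h.\<close>
    let ?F = "{h \<in> carrier G. len h \<le> real n}"
    have "\<not> (finite ?F \<and> ?F \<subseteq> carrier G \<and> (\<forall>x\<in>carrier G. \<exists>h\<in>?F. gp x (h \<otimes> x) \<le> real n))"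
      using False[unfolded not_ex] by (elim allE)
    moreover have "?F \<subseteq> carrier G" by blast
    ultimately obtain y where "y \<in> carrier G" "\<forall>h\<in>?F. \<not> gp y (h \<otimes> y) \<le> real n"
      using finite_ball[of "real n"] by metis
    then show ?thesis by (intro bexI[of _ y]) (simp_all add: not_le)
  qed
  then obtain x where x: "\<And>n. x n \<in> carrier G"
    "\<And>n h. h \<in> carrier G \<Longrightarrow> len h \<le> real n \<Longrightarrow> real n < gp (x n) (h \<otimes> x n)"
    by metis
  show ?thesis
  proof (rule U_property_if_boundary_fixed[of x])
    fix g assume g: "g \<in> carrier G"
    have "eventually (\<lambda>n. real n \<le> gp (x n) (g \<otimes> x n)) sequentially"
      using x(2)[OF g] by (intro eventually_sequentiallyI[of "word_length G S g"]) (auto intro: less_imp_le)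
    then show "filterlim (\<lambda>n. gp (x n) (g \<otimes> x n)) at_top sequentially"
      by (rule filterlim_at_top_mono[OF filterlim_real_sequentially])
  qed (rule x(1))
qed

end

theorem proposition4p2p1:
  fixes G :: "('a, 'b) monoid_scheme" and S :: "'a set"
  assumes "group G"
    and "finite S" and "generating_set G S"
    and "hyperbolic G S"
  shows "U_property G S"
proof -
  interpret group G by fact
  obtain \<delta> where "\<forall>g\<in>carrier G. \<forall>h\<in>carrier G. \<forall>k\<in>carrier G.
      gromov_product G S g k \<ge> min (gromov_product G S g h) (gromov_product G S h k) - \<delta>"
    using \<open>hyperbolic G S\<close> unfolding hyperbolic_def by blast
  then interpret hyperbolic_word_group G S \<delta>
    using assms by unfold_locales auto
  show ?thesis by (rule U_property_hyperbolic)
qed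

end
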